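(* Let $(a_1,\dots,a_m)$ be a tower, i.e. the tower $\tau(w)$ of an element $w\in W(A_m)$, and let $0<l\le j\le m$. Write $(a_1,\dots,a_m)\star a(j,l)$ for the tower $\tau(w\,a(j,l))$. Then $$(a_1,\dots,a_m)\star a(j,l)=(a_1',\dots,a_m'),$$ where $a_m'$ is determined by $(j',a_m',l')=\mu_m(j,a_m,l)$ and, recursively, $$(a_1',\dots,a_{m-1}')=\begin{cases}(a_1,\dots,a_{m-1}), & \text{if } l'=0,\\ (a_1,\dots,a_{m-1})\star a(j',l'), & \text{if } l'>0.\end{cases}$$
   Context: $W(A_m)=\mathsf{Sym}_{m+1}$ on $\{1,\dots,m+1\}$, with generators $s_i=(i,i+1)$, $1\le i\le m$, permutations multiplied from left to right; $W(A_{m-1})=\langle s_1,\dots,s_{m-1}\rangle\le W(A_m)$. For $j\ge0$ put $a(j,0)=1$ and $a(j,k)=s_js_{j-1}\cdots s_{j-k+1}$ for $1\le k\le j$. Every $w\in W(A_m)$ can be written uniquely as $w=a(1,a_1)\,a(2,a_2)\cdots a(m,a_m)$ with integers $0\le a_j\le j$; the tower of $w$ is $\tau(w)=(a_1,\dots,a_m)$. The function $\mu_m$ is defined, for integers $1\le j\le m$, $0\le k\le m$, $0\le l\le j$, by $$\mu_m(j,k,l)=\begin{cases}(j,k,l), & j<m-k,\\ (0,k+l,0), & j=m-k,\\ (j-1,k-1,l-1), & m-k<j\le m-k+l,\\ (j-1,k,l), & j>m-k+l.\end{cases}$$ *)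

theory Defs
  imports "HOL-Combinatorics.Permutations"
begin

definition W :: "nat \<Rightarrow> (nat \<Rightarrow> nat) set" where
  "W m = {w. w permutes {1..m + 1}}"

text \<open>Permutations are multiplied from left to right: the left factor acts first.\<close>

definition lr_mult :: "(nat \<Rightarrow> nat) \<Rightarrow> (nat \<Rightarrow> nat) \<Rightarrow> nat \<Rightarrow> nat" (infixl "\<odot>" 70) where
  "u \<odot> v = v \<circ> u"

definition lr_prod :: "(nat \<Rightarrow> nat) list \<Rightarrow> nat \<Rightarrow> nat" where
  "lr_prod us = foldl (\<odot>) id us"

definition gen :: "nat \<Rightarrow> nat \<Rightarrow> nat" where
  "gen i = transpose i (i + 1)"

text \<open>The element \<open>a(j,k) = s\<^sub>j s\<^sub>j\<^sub>-\<^sub>1 \<dots> s\<^sub>j\<^sub>-\<^sub>k\<^sub>+\<^sub>1\<close>, meaningful for \<open>k \<le> j\<close>; it is the identity for \<open>k = 0\<close>.\<close>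

definition desc :: "nat \<Rightarrow> nat \<Rightarrow> nat \<Rightarrow> nat" where
  "desc j k = lr_prod (map (\<lambda>i. gen (j - i)) [0..<k])"

text \<open>A tower \<open>(a\<^sub>1, \<dots>, a\<^sub>m)\<close> is a list of length \<open>m\<close>; since list positions start
  at \<open>0\<close>, its entry \<open>a\<^sub>i\<close> is \<open>as ! (i - 1)\<close>.\<close>

definition is_tower :: "nat \<Rightarrow> (nat \<Rightarrow> nat) \<Rightarrow> nat list \<Rightarrow> bool" where
  "is_tower m w as \<longleftrightarrow>
     length as = m \<and> (\<forall>i\<in>{1..m}. as ! (i - 1) \<le> i) \<and>
     w = lr_prod (map (\<lambda>i. desc i (as ! (i - 1))) [1..<m + 1])"

definition tower :: "nat \<Rightarrow> (nat \<Rightarrow> nat) \<Rightarrow> nat list" where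
  "tower m w = (THE as. is_tower m w as)"

text \<open>\<open>tower_star m as v\<close> is the tower of \<open>w \<odot> v\<close>, where \<open>w \<in> W m\<close> is the element with tower \<open>as\<close>.\<close>

definition tower_star :: "nat \<Rightarrow> nat list \<Rightarrow> (nat \<Rightarrow> nat) \<Rightarrow> nat list" where
  "tower_star m as v = tower m (inv_into (W m) (tower m) as \<odot> v)"

text \<open>Intended for \<open>1 \<le> j \<le> m\<close>, \<open>k \<le> m\<close>, \<open>l \<le> j\<close>; in this range none of the
  subtractions on natural numbers truncates.\<close>

definition mu :: "nat \<Rightarrow> nat \<Rightarrow> nat \<Rightarrow> nat \<Rightarrow> nat \<times> nat \<times> nat" where
  "mu m j k l =
     (if j < m - k then (j, k, l)
      else if j = m - k then (0, k + l, 0)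
      else if j \<le> m - k + l then (j - 1, k - 1, l - 1)
      else (j - 1, k, l))"

end

(* Both sides are read off from the factorisation w = u a(m, k) with u in W(A_{m-1}): one has
   w a(j, l) = u (a(m, k) a(j, l)) = (u a(j', l')) a(m, k') with (j', k', l') = mu_m(j, k, l),
   and u a(j', l') lies in W(A_{m-1}) again, so uniqueness of towers gives the recursion. *)

theory Submission
  imports Defs
begin

lemma desc_0 [simp]: "desc j 0 = id"
  by (simp add: desc_def lr_prod_def)

lemma desc_Suc: "desc j (Suc k) = desc j k \<odot> gen (j - k)"
  by (simp add: desc_def lr_prod_def)

text \<open>\<open>gen (p + k)\<close> acts first, so \<open>p + k + 1\<close> is carried down by
  all factors in turn, while each point from \<open>p + 1\<close> to \<open>p + k\<close> is moved
  by one factor only, upwards. The index \<open>p + k\<close> avoids truncated subtraction. The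
  induction strips the last factor \<open>gen (Suc p)\<close>, hence \<open>p\<close> must
  vary.\<close>

lemma desc_apply_add:
  "desc (p + k) k x = (if x = p + k + 1 then p + 1 else if p < x \<and> x \<le> p + k then x + 1 else x)"
proof (induction k arbitrary: p)
  case (Suc k)
  have "desc (p + Suc k) (Suc k) x = gen (Suc p) (desc (Suc p + k) k x)"
    by (simp add: desc_Suc lr_mult_def)
  then show ?case
    unfolding Suc.IH by (simp add: gen_def transpose_def)
qed simp

lemma desc_apply_top: "k \<le> j \<Longrightarrow> desc j k (j + 1) = j + 1 - k"
  using desc_apply_add[of "j - k" k "j + 1"] by simp

lemma lr_mult_in_W: "u \<in> W m \<Longrightarrow> v \<in> W m \<Longrightarrow> u \<odot> v \<in> W m"
  by (simp add: W_def lr_mult_def permutes_compose)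

lemma lr_mult_assoc: "(u \<odot> v) \<odot> w = u \<odot> (v \<odot> w)"
  by (simp add: lr_mult_def comp_assoc)

lemma W_mono: "m \<le> n \<Longrightarrow> W m \<subseteq> W n"
  by (auto simp: W_def intro: permutes_subset)

lemma desc_in_W: "k \<le> j \<Longrightarrow> j \<le> m \<Longrightarrow> desc j k \<in> W m"
proof (induction k)
  case 0
  then show ?case using permutes_id by (simp add: W_def id_def)
next
  case (Suc k)
  then have "gen (j - k) \<in> W m"
    unfolding gen_def W_def by (intro CollectI permutes_swap_id) auto
  with Suc show ?case by (simp add: desc_Suc lr_mult_in_W)
qed

lemma is_tower_0: "is_tower 0 w as \<longleftrightarrow> w = id \<and> as = []"
  by (auto simp: is_tower_def lr_prod_def)

text \<open>Peels off the last entry, so that facts about towers follow by induction on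
  \<open>m\<close>.\<close>

lemma is_tower_Suc:
  "is_tower (Suc m) w as \<longleftrightarrow>
     (\<exists>u bs k. as = bs @ [k] \<and> is_tower m u bs \<and> k \<le> Suc m \<and> w = u \<odot> desc (Suc m) k)"
proof -
  \<comment> \<open>The product over the first \<open>m\<close> positions sees only
    \<open>bs\<close>; it is the witness for \<open>u\<close>.\<close>
  have snoc: "is_tower (Suc m) w (bs @ [k]) \<longleftrightarrow>
      k \<le> Suc m \<and> is_tower m (lr_prod (map (\<lambda>i. desc i (bs ! (i - 1))) [1..<m + 1])) bs \<and>
      w = lr_prod (map (\<lambda>i. desc i (bs ! (i - 1))) [1..<m + 1]) \<odot> desc (Suc m) k"
    if len: "length bs = m" for bs k
  proof -
    have map: "map (\<lambda>i. desc i ((bs @ [k]) ! (i - 1))) [1..<m + 1] =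
        map (\<lambda>i. desc i (bs ! (i - 1))) [1..<m + 1]"
      using len by (intro map_cong) (auto simp: nth_append)
    have upt: "[1..<Suc m + 1] = [1..<m + 1] @ [Suc m]"
      by simp
    have bnd: "(\<forall>i\<in>{1..Suc m}. (bs @ [k]) ! (i - 1) \<le> i) \<longleftrightarrow>
        k \<le> Suc m \<and> (\<forall>i\<in>{1..m}. bs ! (i - 1) \<le> i)"
    proof -
      have "{1..Suc m} = insert (Suc m) {1..m}" by auto
      then show ?thesis using len by (auto simp: nth_append)
    qed
    show ?thesis
      unfolding is_tower_def bnd upt map_append map
      using len by (auto simp: lr_prod_def nth_append)
  qed
  show ?thesis
  proof
    assume tw: "is_tower (Suc m) w as"
    then have "length as = Suc m" by (simp add: is_tower_def)
    then obtain bs k where as: "as = bs @ [k]" "length bs = m"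
      by (metis length_Suc_conv_rev)
    with tw snoc show "\<exists>u bs k. as = bs @ [k] \<and> is_tower m u bs \<and> k \<le> Suc m \<and>
        w = u \<odot> desc (Suc m) k"
      by blast
  next
    assume "\<exists>u bs k. as = bs @ [k] \<and> is_tower m u bs \<and> k \<le> Suc m \<and> w = u \<odot> desc (Suc m) k"
    then obtain u bs k where *: "as = bs @ [k]" "is_tower m u bs" "k \<le> Suc m"
        "w = u \<odot> desc (Suc m) k"
      by blast
    then have "length bs = m" "u = lr_prod (map (\<lambda>i. desc i (bs ! (i - 1))) [1..<m + 1])"
      by (simp_all add: is_tower_def)
    with * snoc[of bs k] show "is_tower (Suc m) w as" by simp
  qed
qed

lemma is_tower_in_W: "is_tower m w as \<Longrightarrow> w \<in> W m"
proof (induction m arbitrary: w as)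
  case 0
  then show ?case by (simp add: is_tower_0 W_def id_def)
next
  case (Suc m)
  then obtain u bs k where "is_tower m u bs" "k \<le> Suc m" "w = u \<odot> desc (Suc m) k"
    by (auto simp: is_tower_Suc)
  with Suc.IH W_mono[of m "Suc m"] show ?case
    by (auto intro!: lr_mult_in_W desc_in_W)
qed

text \<open>\<open>W m\<close> is the stabiliser of \<open>m + 2\<close> in
  \<open>W (Suc m)\<close>, and the elements \<open>desc (Suc m) k\<close> represent its cosets:
  they send \<open>m + 2\<close> to \<open>m + 2 - k\<close>, which covers every possible
  image.\<close>

lemma W_Suc_decomp:
  assumes "w \<in> W (Suc m)"
  obtains u k where "u \<in> W m" "k \<le> Suc m" "w = u \<odot> desc (Suc m) k"
proof -
  define k where "k = m + 2 - w (m + 2)"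
  have "w (m + 2) \<in> {1..m + 2}"
    using assms permutes_in_image[of w "{1..m + 2}" "m + 2"] by (simp add: W_def)
  then have k: "k \<le> Suc m" "w (m + 2) = m + 2 - k"
    by (auto simp: k_def)
  define d where "d = desc (Suc m) k"
  have d: "d permutes {1..m + 2}"
    using desc_in_W[OF k(1) order_refl] by (simp add: W_def d_def)
  have "d (m + 2) = w (m + 2)"
    using k desc_apply_top[of k "Suc m"] by (simp add: d_def)
  \<comment> \<open>Read from left to right, this is \<open>w\<close> followed by the inverse of
    \<open>d\<close>; it fixes \<open>m + 2\<close> because \<open>d\<close> and \<open>w\<close>
    agree there.\<close>
  define u where "u = inv d \<circ> w"
  have u_superset: "u permutes {1..m + 2}"
    using assms d by (simp add: u_def W_def permutes_compose permutes_inv)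
  have "u (m + 2) = m + 2"
    using \<open>d (m + 2) = w (m + 2)\<close> permutes_inverses(2)[OF d] by (metis u_def comp_apply)
  then have "u x = x" if "x \<in> {1..m + 2} - {1..m + 1}" for x
    using that by (cases "x = m + 2") auto
  with u_superset have "u permutes {1..m + 1}"
    by (rule permutes_superset)
  moreover have "w = u \<odot> d"
    using permutes_inv_o(1)[OF d] by (simp add: lr_mult_def u_def flip: comp_assoc)
  ultimately show ?thesis
    using that k(1) by (simp add: W_def d_def)
qed

text \<open>Elements of \<open>W m\<close> fix \<open>m + 2\<close>, so the product sends it to
  \<open>m + 2 - k\<close>, which reveals \<open>k\<close>; the common factor then cancels. This is
  the source of uniqueness of towers.\<close>

lemma lr_mult_desc_eq_iff:
  assumes "u \<in> W m" "v \<in> W m" "k \<le> Suc m" "l \<le> Suc m"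
  shows "u \<odot> desc (Suc m) k = v \<odot> desc (Suc m) l \<longleftrightarrow> u = v \<and> k = l"
proof
  assume eq: "u \<odot> desc (Suc m) k = v \<odot> desc (Suc m) l"
  have "u (m + 2) = m + 2" "v (m + 2) = m + 2"
    using assms(1,2) by (simp_all add: W_def permutes_not_in)
  with fun_cong[OF eq, of "m + 2"] assms(3,4) have "k = l"
    using desc_apply_top[of k "Suc m"] desc_apply_top[of l "Suc m"] by (simp add: lr_mult_def)
  moreover have "inj (desc (Suc m) k)"
    using desc_in_W[OF assms(3) order_refl] permutes_inj unfolding W_def by blast
  ultimately have "u x = v x" for x
    using fun_cong[OF eq, of x] by (simp add: lr_mult_def inj_eq)
  with \<open>k = l\<close> show "u = v \<and> k = l"
    by blast
qed simp

lemma is_tower_ex: "w \<in> W m \<Longrightarrow> \<exists>as. is_tower m w as"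
proof (induction m arbitrary: w)
  case 0
  then show ?case by (auto simp: is_tower_0 W_def id_def)
next
  case (Suc m)
  then obtain u k where "u \<in> W m" "k \<le> Suc m" "w = u \<odot> desc (Suc m) k"
    using W_Suc_decomp by blast
  with Suc.IH show ?case by (fastforce simp: is_tower_Suc)
qed

lemma is_tower_unique: "is_tower m w as \<Longrightarrow> is_tower m w bs \<Longrightarrow> as = bs"
proof (induction m arbitrary: w as bs)
  case 0
  then show ?case by (simp add: is_tower_0)
next
  case (Suc m)
  then show ?case
    unfolding is_tower_Suc using lr_mult_desc_eq_iff is_tower_in_W by metis
qed

lemma tower_eq: "is_tower m w as \<Longrightarrow> tower m w = as"
  unfolding tower_def by (blast intro: is_tower_unique)

lemma is_tower_tower: "w \<in> W m \<Longrightarrow> is_tower m w (tower m w)"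
  using is_tower_ex tower_eq by metis

text \<open>\<open>is_tower\<close> expresses the element as a product computed from the list alone.
  Injectivity makes \<open>inv_into\<close> in \<open>tower_star\<close> return the original
  element.\<close>

lemma inj_on_tower: "inj_on (tower m) (W m)"
  by (rule inj_onI) (metis is_tower_tower is_tower_def)

lemma tower_star_tower: "w \<in> W m \<Longrightarrow> tower_star m (tower m w) v = tower m (w \<odot> v)"
  by (simp add: tower_star_def inj_on_tower)

lemma tower_lr_mult_desc:
  "u \<in> W m \<Longrightarrow> k \<le> Suc m \<Longrightarrow> tower (Suc m) (u \<odot> desc (Suc m) k) = tower m u @ [k]"
  by (rule tower_eq) (auto simp: is_tower_Suc intro: is_tower_tower)

text \<open>Guarantees that \<open>k'\<close> is an admissible last entry and that
  \<open>desc j' l'\<close> lies in \<open>W m\<close>.\<close>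

lemma mu_bounds:
  assumes "k \<le> Suc m" "0 < l" "l \<le> j" "j \<le> Suc m" "mu (Suc m) j k l = (j', k', l')"
  shows "k' \<le> Suc m" "l' \<le> j'" "j' \<le> m"
  using assms by (auto simp: mu_def split: if_splits)

text \<open>In terms of words, with \<open>p = m - k\<close> and \<open>q = j - l\<close>: for
  \<open>j < p\<close> the factors have disjoint supports; for \<open>j = p\<close> the words
  concatenate; for \<open>p < q\<close> moving each generator to the left past
  \<open>desc m k\<close> lowers its index by one. For \<open>q \<le> p < j\<close> the generators
  above \<open>p + 1\<close> are lowered, \<open>gen (p + 1)\<close> cancels the last letter of
  \<open>desc m k\<close>, and those below commute past the rest. The proof compares values
  pointwise instead.\<close>

lemma desc_mult_desc:
  assumes "k \<le> m" "0 < l" "l \<le> j" "j \<le> m" "mu m j k l = (j', k', l')"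
  shows "desc m k \<odot> desc j l = desc j' l' \<odot> desc m k'"
proof -
  obtain p q where m: "m = p + k" and j: "j = q + l"
    using assms(1,3) by (metis le_add_diff_inverse2)
  note dk = desc_apply_add[of p k] and dl = desc_apply_add[of q l]
  note mu = assms(5)[unfolded m j mu_def, simplified]
  \<comment> \<open>These are the four clauses of \<open>mu\<close>:
    \<open>j \<le> m - k + l\<close> becomes \<open>q \<le> p\<close>.\<close>
  consider "q + l < p" | "p = q + l" | "p < q + l" "q \<le> p" | "p < q"
    by linarith
  then show ?thesis
  proof cases
    case 1
    with mu have "j' = q + l" "k' = k" "l' = l"
      by auto
    with 1 show ?thesis
      by (simp add: fun_eq_iff lr_mult_def m j dk dl)
  next
    case 2
    with mu have "j' = 0" "k' = k + l" "l' = 0"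
      by auto
    have "desc m (k + l) x = (if x = m + 1 then q + 1 else if q < x \<and> x \<le> m then x + 1 else x)" for x
      using desc_apply_add[of q "k + l" x] 2 m by (simp add: ac_simps)
    moreover have "p = j" "q \<le> j"
      using 2 j by simp_all
    ultimately show ?thesis
      using \<open>j' = 0\<close> \<open>k' = k + l\<close> \<open>l' = 0\<close> \<open>j \<le> m\<close>
      by (simp add: fun_eq_iff lr_mult_def dk[folded m] dl[folded j])
  next
    case 3
    \<comment> \<open>\<open>k\<close> is positive since \<open>p < j \<le> m = p + k\<close>. Now
      \<open>m = Suc p + k0\<close> and \<open>j - 1 = q + l0\<close> have the shape that
      \<open>desc_apply_add\<close> needs.\<close>
    with assms(2,4) m j obtain k0 l0 where kl: "k = Suc k0" "l = Suc l0"
      by (cases k; cases l) auto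
    with 3 mu have "j' = q + l0" "k' = k0" "l' = l0"
      by (auto split: if_splits)
    have "desc (q + l) l (desc (p + k) k x) = desc (Suc p + k0) k0 (desc (q + l0) l0 x)" for x
    proof -
      consider "x = p + k + 1" | "p < x" "x \<le> p + k" | "x \<le> p" | "p + k + 1 < x"
        by linarith
      then show ?thesis
        unfolding desc_apply_add using 3 kl \<open>j \<le> m\<close>[unfolded m j] by cases auto
    qed
    with \<open>j' = q + l0\<close> \<open>k' = k0\<close> \<open>l' = l0\<close> show ?thesis
      by (simp add: fun_eq_iff lr_mult_def m j kl)
  next
    case 4
    then obtain q0 where q: "q = Suc q0"
      by (cases q) auto
    with 4 mu have "j' = q0 + l" "k' = k" "l' = l"
      by (auto split: if_splits)
    have "desc (q + l) l (desc (p + k) k x) = desc (p + k) k (desc (q0 + l) l x)" for x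
    proof -
      \<comment> \<open>Split by the action of \<open>desc (p + k) k\<close>: the top point, the
        raised points, and the fixed points on either side.\<close>
      consider "x = p + k + 1" | "p < x" "x \<le> p + k" | "x \<le> p" | "p + k + 1 < x"
        by linarith
      then show ?thesis
        unfolding desc_apply_add using 4 q \<open>j \<le> m\<close>[unfolded m j] by cases auto
    qed
    with \<open>j' = q0 + l\<close> \<open>k' = k\<close> \<open>l' = l\<close> show ?thesis
      by (simp add: fun_eq_iff lr_mult_def m j)
  qed
qed

theorem proposition2p8:
  fixes m j l :: nat and w :: "nat \<Rightarrow> nat" and as :: "nat list"
  assumes "w \<in> W m" and "as = tower m w"
    and "0 < l" and "l \<le> j" and "j \<le> m"
  shows "tower_star m as (desc j l) =
    (let (j', a', l') = mu m j (as ! (m - 1)) l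
     in (if l' = 0 then take (m - 1) as
         else tower_star (m - 1) (take (m - 1) as) (desc j' l')) @ [a'])"
proof -
  obtain n where m: "m = Suc n"
    using assms(3-5) by (cases m) auto
  obtain u k where u: "u \<in> W n" and k: "k \<le> Suc n" and w: "w = u \<odot> desc (Suc n) k"
    using assms(1) m W_Suc_decomp by blast
  have as: "as = tower n u @ [k]"
    using assms(2) m w tower_lr_mult_desc[OF u k] by simp
  have "length (tower n u) = n"
    using is_tower_tower[OF u] by (simp add: is_tower_def)
  with as m have last: "as ! (m - 1) = k" and init: "take (m - 1) as = tower n u"
    by (simp_all add: nth_append)
  obtain j' k' l' where mu: "mu (Suc n) j k l = (j', k', l')"
    by (cases "mu (Suc n) j k l") auto
  note bounds = mu_bounds[OF k assms(3,4) _ mu, folded m, OF assms(5)]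
  have "tower_star m as (desc j l) = tower m (w \<odot> desc j l)"
    using assms(1,2) by (simp add: tower_star_tower)
  also have "w \<odot> desc j l = (u \<odot> desc j' l') \<odot> desc (Suc n) k'"
    using desc_mult_desc[OF k assms(3,4) _ mu] assms(5) m by (simp add: w lr_mult_assoc)
  also have "tower m \<dots> = tower n (u \<odot> desc j' l') @ [k']"
    using bounds m u by (auto intro!: tower_lr_mult_desc lr_mult_in_W desc_in_W)
  \<comment> \<open>For \<open>l' = 0\<close> the factor \<open>desc j' l'\<close> is
    \<open>id\<close>, so the tower of \<open>u\<close> stays unchanged.\<close>
  also have "tower n (u \<odot> desc j' l') =
      (if l' = 0 then tower n u else tower_star n (tower n u) (desc j' l'))"
    using u by (simp add: tower_star_tower lr_mult_def)
  finally show ?thesis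
    unfolding last init using m mu by simp
qed

end
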